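(* Let $p\in(0,1)$, $q=1-p$, and suppose $X_\infty$ is geometric with parameter $p$ on $\{1,2,\dots\}$, so that $F_\infty(j)=\mathbf{P}(X_\infty\le j)=1-q^j$. Then $\overline{F}_\infty(j)=1-F_\infty(j)=q^j=\int_0^1u^j\lambda(du)$ with $\lambda=\delta_q$, so this sequence is completely monotone and $X_\infty-1$ is infinitely divisible. Moreover: (i) The solution $F$ of the functional equation $F_\infty(j)=\Phi_\infty(F(j))$, $j\ge1$, where $\Phi_\infty(z)=\mathbf{E}(z^{X_\infty})$, is $$\mathbf{P}(\nu\le j)=F(j)=\frac{1-q^j}{1-q^{j+1}},\qquad j=1,2,\dots$$ (ii) The sequence $\overline{F}(j)=1-F(j)=\mathbf{P}(\nu>j)$, $j\ge0$, is completely monotone, and so $\nu-1$ is infinitely divisible. The distribution $F$ has decreasing failure rate. (iii) The branching number $\nu$ can be generated in the following two ways (equalities in distribution): (iii-a) $\nu=\inf\left(i\ge1:\mathcal{B}_i(\alpha_i)=1\right)$, where $(\mathcal{B}_i(\alpha_i);\,i\ge1)$ is an independent sequence of Bernoulli random variables with success parameters $\alpha_i=1/(1+q+\dots+q^i)$; (iii-b) $\nu=\min_{i=1,\dots,G}\xi_i$, where $G$ is geometric with parameter $p$ on $\{1,2,\dots\}$, independent of the i.i.d. sequence $(\xi_i,\ i\ge1)$, with $\xi_1$ geometric with parameter $p$ on $\{1,2,\dots\}$. (iv) The tails of both $\nu$ and $X_\infty$ are geometric, with $\mathbf{P}(\nu>j)/\mathbf{P}(X_\infty>j)\to p<1$ as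 $j\to\infty$.
   Context: Geometric with parameter $p$ on $\{1,2,\dots\}$ means $\mathbf{P}(X=k)=pq^{k-1}$, $k\ge1$. A $[0,1]$-valued sequence $(a_j)_{j\ge0}$ is completely monotone if $(-1)^k\Delta^{(k)}a_j\ge0$ for all $j,k\ge0$, where $\Delta a_j=a_{j+1}-a_j$ and $\Delta^{(k)}$ is the $k$-th iterate. A distribution of $\nu$ on $\{1,2,\dots\}$ has decreasing failure rate if $r_j=\mathbf{P}(\nu=j)/\mathbf{P}(\nu\ge j)$ is decreasing in $j$. The functional equation expresses that the law of $X_\infty$ is invariant for the Lamperti maximal branching process $X_{n+1}=\max_{j=1,\dots,X_n}\nu_{j,n+1}$ with $\nu_{j,n+1}$ i.i.d. copies of $\nu$. *)

theory Defs
  imports "HOL-Probability.Probability"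
begin

text \<open>Random variables with values in \<open>{1,2,...}\<close> are represented as measurable maps into
  \<open>nat\<close> which are positive almost surely. For the geometric law this is forced,
  because the probabilities of the positive values already add up to 1.\<close>

definition geometric_rv :: "'a measure \<Rightarrow> real \<Rightarrow> ('a \<Rightarrow> nat) \<Rightarrow> bool" where
  "geometric_rv M p X \<longleftrightarrow>
     X \<in> measurable M (count_space UNIV) \<and>
     (\<forall>k\<ge>1. \<P>(\<omega> in M. X \<omega> = k) = p * (1 - p) ^ (k - 1))"

definition pgf :: "'a measure \<Rightarrow> ('a \<Rightarrow> nat) \<Rightarrow> real \<Rightarrow> real" where
  "pgf M X z = (\<integral>\<omega>. z ^ X \<omega> \<partial>M)"

text \<open>\<open>branching_number M X N \<nu>\<close>: the law of \<open>X\<close> solves the functional equation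
  (is invariant) for the maximal branching process with branching number \<open>\<nu>\<close>.\<close>

definition branching_number ::
    "'a measure \<Rightarrow> ('a \<Rightarrow> nat) \<Rightarrow> 'b measure \<Rightarrow> ('b \<Rightarrow> nat) \<Rightarrow> bool" where
  "branching_number M X N \<nu> \<longleftrightarrow>
     prob_space N \<and> \<nu> \<in> measurable N (count_space UNIV) \<and> (AE \<omega> in N. 1 \<le> \<nu> \<omega>) \<and>
     (\<forall>j\<ge>1. \<P>(\<omega> in M. X \<omega> \<le> j) = pgf M X (\<P>(\<omega> in N. \<nu> \<omega> \<le> j)))"

definition fwd_diff :: "(nat \<Rightarrow> real) \<Rightarrow> nat \<Rightarrow> real" where
  "fwd_diff a j = a (Suc j) - a j"

definition completely_monotone :: "(nat \<Rightarrow> real) \<Rightarrow> bool" where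
  "completely_monotone a \<longleftrightarrow>
     (\<forall>j. a j \<in> {0..1}) \<and> (\<forall>j k. 0 \<le> (-1) ^ k * (fwd_diff ^^ k) a j)"

definition decreasing_failure_rate :: "'a measure \<Rightarrow> ('a \<Rightarrow> nat) \<Rightarrow> bool" where
  "decreasing_failure_rate M Y \<longleftrightarrow>
     monotone_on {j. 1 \<le> j \<and> \<P>(\<omega> in M. j \<le> Y \<omega>) > 0} (\<le>) (\<ge>)
       (\<lambda>j. \<P>(\<omega> in M. Y \<omega> = j) / \<P>(\<omega> in M. j \<le> Y \<omega>))"

primrec convolution_power :: "real measure \<Rightarrow> nat \<Rightarrow> real measure" where
  "convolution_power \<mu> 0 = return borel 0"
| "convolution_power \<mu> (Suc n) = convolution \<mu> (convolution_power \<mu> n)"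

definition infinitely_divisible :: "real measure \<Rightarrow> bool" where
  "infinitely_divisible \<mu> \<longleftrightarrow>
     real_distribution \<mu> \<and>
     (\<forall>n\<ge>1. \<exists>\<rho>. real_distribution \<rho> \<and> convolution_power \<rho> n = \<mu>)"

text \<open>The tail is asymptotically, not necessarily exactly, geometric.\<close>

definition geometric_tail :: "'a measure \<Rightarrow> ('a \<Rightarrow> nat) \<Rightarrow> real \<Rightarrow> bool" where
  "geometric_tail M Y r \<longleftrightarrow> 0 < r \<and> r < 1 \<and>
     (\<exists>c>0. (\<lambda>j. \<P>(\<omega> in M. Y \<omega> > j)) \<sim>[at_top] (\<lambda>j. c * r ^ j))"

text \<open>The library's \<open>indep_var\<close> requires both variables to have the same value type; this is the
  same notion for different value types.\<close>

definition (in prob_space) indep_rvs ::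
    "'b measure \<Rightarrow> ('a \<Rightarrow> 'b) \<Rightarrow> 'c measure \<Rightarrow> ('a \<Rightarrow> 'c) \<Rightarrow> bool" where
  "indep_rvs S X T Y \<longleftrightarrow>
     random_variable S X \<and> random_variable T Y \<and>
     indep_set {X -` A \<inter> space M | A. A \<in> sets S} {Y -` A \<inter> space M | A. A \<in> sets T}"

end

theory Submission
  imports Defs "HOL-Computational_Algebra.Formal_Power_Series"
begin

unbundle no vec_syntax and fps_syntax

text \<open>The generating function of \<open>X\<close> is \<open>p z / (1 - q z)\<close>, so the functional equation is linear in
  \<open>F j\<close>, and \<open>P(\<nu> > j) = p q^j / (1 - q^(j+1))\<close>. Expanding the geometric series,
  \<open>P(\<nu> > j) = (\<Sum>m. p q^m (q^(m+1))^j)\<close> is a mixture of geometric sequences, hence completely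
  monotone; the \<open>m\<close>-th term is the contribution of \<open>G = m + 1\<close> to the tail of the minimum. The failure rate is
  \<open>p / (1 - q^(j+1)) = \<alpha>_j\<close>, which gives the Bernoulli representation.

  Infinite divisibility holds for every positive log-convex law on the naturals: Kaluza's recursion
  shows that the logarithmic derivative of the generating function has nonnegative coefficients, and
  these generate the coefficients of every root of the generating function.\<close>

section \<open>Infinite divisibility of log-convex laws\<close>

text \<open>Log-convexity says that the ratios \<open>\<rho> n\<close> of successive coefficients
  increase. In the recursion for the coefficients of \<open>f'/f\<close>, this bounds the terms with
  index below \<open>n\<close> by \<open>n * f $ Suc n\<close>, while the whole sum is
  \<open>Suc n * f $ Suc n\<close>, so the last term is at least \<open>f $ Suc n\<close>, which is
  positive.\<close>

lemma log_convex_imp_log_deriv_nonneg: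
  fixes f :: "real fps"
  assumes pos: "\<And>n. f $ n > 0"
    and convex: "\<And>n. f $ Suc n * f $ Suc n \<le> f $ n * f $ Suc (Suc n)"
  shows "(fps_deriv f * inverse f) $ n \<ge> 0"
proof -
  define r where "r = fps_deriv f * inverse f"
  define \<rho> where "\<rho> n = f $ Suc n / f $ n" for n
  have "\<rho> n \<le> \<rho> (Suc n)" for n
    using pos convex by (simp add: \<rho>_def divide_simps mult.commute)
  then have mono: "\<rho> i \<le> \<rho> j" if "i \<le> j" for i j
    using lift_Suc_mono_le that by metis
  have step: "f $ Suc i \<le> f $ i * \<rho> j" if "i \<le> j" for i j
  proof -
    have "f $ Suc i = f $ i * \<rho> i"
      using pos[of i] by (simp add: \<rho>_def)
    then show ?thesis
      using mono[OF that] pos[of i] by simp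
  qed
  have "r * f = fps_deriv f"
    using pos[of 0] by (simp add: r_def mult.assoc inverse_mult_eq_1)
  \<comment> \<open>The equation \<open>r * f = f'\<close> read off coefficientwise; it determines
    \<open>r $ n\<close> from the earlier coefficients.\<close>
  then have coeff: "(\<Sum>i\<le>n. r $ i * f $ (n - i)) = real (Suc n) * f $ Suc n" for n
    by (metis Suc_eq_plus1 atLeast0AtMost fps_deriv_nth fps_mult_nth)
  have "r $ n \<ge> 0"
  proof (induction n rule: less_induct)
    case (less n)
    show ?case
    proof (cases n)
      case 0
      have "r $ 0 * f $ 0 = f $ 1"
        using coeff[of 0] by simp
      then show ?thesis
        using pos[of 0] pos[of 1] 0 by (metis less_le zero_less_mult_pos2)
    next
      case (Suc m)
      \<comment> \<open>Raising the index of \<open>f\<close> by one costs at most the factor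
        \<open>\<rho> n\<close>; what remains is the recursion at index \<open>m\<close>, whose
        value is known.\<close>
      have "(\<Sum>i\<le>m. r $ i * f $ (n - i)) \<le> (\<Sum>i\<le>m. r $ i * (f $ (m - i) * \<rho> n))"
        using less Suc step by (intro sum_mono mult_left_mono) (auto simp: Suc_diff_le)
      also have "\<dots> = real (Suc m) * f $ Suc m * \<rho> n"
        by (subst coeff[of m, symmetric]) (simp add: sum_distrib_right mult.assoc)
      also have "\<dots> = real n * f $ Suc n"
        using pos[of n] Suc by (simp add: \<rho>_def)
      finally have "real n * f $ Suc n + r $ n * f $ 0 \<ge> real (Suc n) * f $ Suc n"
        using coeff[of n] Suc by simp
      then have "r $ n * f $ 0 \<ge> f $ Suc n"
        by (simp add: algebra_simps)
      then show ?thesis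
        using pos[of 0] pos[of "Suc n"] by (smt (verit) mult_neg_pos)
    qed
  qed
  then show ?thesis
    by (simp add: r_def)
qed

text \<open>A root \<open>g\<close> of \<open>f\<close> solves \<open>n g' = (f'/f) g\<close>, which is a recursion for the coefficients
  of \<open>g\<close> without negative terms.\<close>

lemma fps_root_nonneg:
  fixes f :: "real fps"
  assumes f0: "f $ 0 > 0" and r: "\<And>k. (fps_deriv f * inverse f) $ k \<ge> 0" and n: "n \<ge> 1"
  obtains g where "g ^ n = f" "g $ 0 > 0" "\<And>k. g $ k \<ge> 0"
proof -
  obtain m where m: "n = Suc m"
    using n by (cases n) auto
  \<comment> \<open>The radical starts from the real \<open>n\<close>-th root of the constant term,
    which makes \<open>g $ 0\<close> positive.\<close>
  define g where "g = fps_radical (\<lambda>n x. root n x) n f"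
  have gn: "g ^ n = f"
    unfolding g_def m using f0 by (subst power_radical[symmetric]) (auto simp del: power_Suc)
  have g0: "g $ 0 > 0"
    using f0 m by (simp add: g_def)
  have gm: "g ^ m \<noteq> 0" "g \<noteq> 0"
    using g0 by auto
  define s where "s = fps_deriv f * inverse f"
  \<comment> \<open>Both sides of the differentiated equation \<open>g ^ n = f\<close> are written
    with the factor \<open>g ^ m\<close>, which is nonzero and therefore cancels.\<close>
  have "g ^ m * (of_nat n * fps_deriv g) = fps_deriv f"
    unfolding gn[symmetric] m by (simp add: fps_deriv_power fps_of_nat mult_ac del: power_Suc of_nat_Suc)
  also have "\<dots> = s * f"
    using f0 by (simp add: s_def mult.assoc inverse_mult_eq_1)
  also have "\<dots> = g ^ m * (s * g)"
    unfolding gn[symmetric] m by (simp add: mult_ac)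
  finally have eq: "of_nat n * fps_deriv g = s * g"
    using gm by simp
  have rec: "real n * (real (Suc k) * g $ Suc k) = (\<Sum>i=0..k. s $ i * g $ (k - i))" for k
  proof -
    have "(of_nat n * fps_deriv g) $ k = real n * (real (Suc k) * g $ Suc k)"
      by (simp add: fps_of_nat[symmetric] del: of_nat_Suc)
    then show ?thesis
      by (simp only: eq fps_mult_nth)
  qed
  have "g $ k \<ge> 0" for k
  proof (induction k rule: less_induct)
    case (less k)
    show ?case
    proof (cases k)
      case 0
      then show ?thesis using g0 by simp
    next
      case (Suc l)
      have "0 \<le> (\<Sum>i=0..l. s $ i * g $ (l - i))"
        using less Suc r by (intro sum_nonneg mult_nonneg_nonneg) (auto simp: s_def)
      also have "\<dots> = real n * real k * g $ k"
        by (simp only: rec[symmetric] Suc mult.assoc)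
      finally show ?thesis
        using n Suc by (simp add: zero_le_mult_iff not_le mult_le_0_iff)
    qed
  qed
  then show thesis
    using that gn g0 by blast
qed

text \<open>Nonnegative terms converge absolutely, so the Cauchy product of the series has the
  product of the sums as its sum. Nonnegativity of the powers is part of the induction in order to
  keep the convergence absolute.\<close>

lemma fps_power_sums:
  fixes g :: "real fps"
  assumes nonneg: "\<And>k. g $ k \<ge> 0" and sums: "(\<lambda>k. g $ k) sums s"
  shows "(\<lambda>k. (g ^ n) $ k) sums (s ^ n) \<and> (\<forall>k. (g ^ n) $ k \<ge> 0)"
proof (induction n)
  case 0
  have "(\<lambda>k. (1 :: real fps) $ k) sums (1 :: real)"
    using sums_single[of 0 "\<lambda>_. 1 :: real"] by (simp add: fps_one_nth eq_commute cong: if_cong)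
  then show ?case
    by simp
next
  case (Suc n)
  have "(\<lambda>k. \<Sum>i\<le>k. g $ i * (g ^ n) $ (k - i)) sums ((\<Sum>k. g $ k) * (\<Sum>k. (g ^ n) $ k))"
    using Suc sums nonneg by (intro Cauchy_product_sums) (auto simp: sums_iff)
  then have "(\<lambda>k. (g ^ Suc n) $ k) sums (s * s ^ n)"
    using Suc sums by (simp add: fps_mult_nth atLeast0AtMost sums_iff)
  moreover have "(g ^ Suc n) $ k \<ge> 0" for k
    using Suc nonneg by (auto simp: fps_mult_nth intro!: sum_nonneg)
  ultimately show ?case
    by simp
qed

text \<open>Convergence of the root series comes first, by comparison: up to a positive constant its
  coefficients are dominated by those of \<open>g ^ n\<close>. Its sum is then a nonnegative real
  whose \<open>n\<close>-th power is 1.\<close>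

lemma fps_root_sums_1:
  fixes g :: "real fps"
  assumes nonneg: "\<And>k. g $ k \<ge> 0" and g0: "g $ 0 > 0" and n: "n \<ge> 1"
    and sums: "(\<lambda>k. (g ^ n) $ k) sums 1"
  shows "(\<lambda>k. g $ k) sums 1"
proof -
  \<comment> \<open>Among the nonnegative terms of the \<open>k\<close>-th coefficient of the power,
    only the one taking \<open>g $ k\<close> from one factor and the constant term from all others
    is kept.\<close>
  have dom: "g $ k * (g $ 0) ^ m \<le> (g ^ Suc m) $ k \<and> 0 \<le> (g ^ Suc m) $ k" for k m
  proof (induction m arbitrary: k)
    case 0
    then show ?case using nonneg by (simp del: One_nat_def)
  next
    case (Suc m)
    have "g $ k * (g $ 0) ^ Suc m = g $ 0 * (g $ k * (g $ 0) ^ m)"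
      by simp
    also have "\<dots> \<le> g $ 0 * (g ^ Suc m) $ (k - 0)"
      using Suc[of k] nonneg[of 0] by (intro mult_left_mono) auto
    also have "\<dots> \<le> (\<Sum>i=0..k. g $ i * (g ^ Suc m) $ (k - i))"
      using Suc nonneg by (intro member_le_sum) auto
    also have "\<dots> = (g ^ Suc (Suc m)) $ k"
      by (simp only: power_Suc[of g "Suc m"] fps_mult_nth)
    finally have *: "g $ k * (g $ 0) ^ Suc m \<le> (g ^ Suc (Suc m)) $ k" .
    moreover have "0 \<le> g $ k * (g $ 0) ^ Suc m"
      using nonneg by simp
    ultimately show ?case
      by linarith
  qed
  obtain m where m: "n = Suc m"
    using n by (cases n) auto
  have "summable (\<lambda>k. (g ^ n) $ k / (g $ 0) ^ m)"
    using sums by (intro summable_divide) (simp add: sums_iff)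
  then have "summable (\<lambda>k. g $ k)"
    by (rule summable_comparison_test'[where N=0])
      (use dom g0 nonneg in \<open>auto simp: m field_simps simp del: power_Suc\<close>)
  then have s: "(\<lambda>k. g $ k) sums (\<Sum>k. g $ k)"
    by (simp add: summable_sums)
  then have "(\<lambda>k. (g ^ n) $ k) sums ((\<Sum>k. g $ k) ^ n)"
    using fps_power_sums[of g, OF nonneg] by blast
  then have "(\<Sum>k. g $ k) ^ n = 1"
    using sums sums_unique2 by blast
  moreover have "(\<Sum>k. g $ k) \<ge> 0"
    using s nonneg by (simp add: suminf_nonneg sums_iff)
  ultimately have "(\<Sum>k. g $ k) = 1"
    using n by (metis m power_eq_1_iff real_norm_def abs_of_nonneg nat.distinct(1))
  then show ?thesis
    using s by simp
qed

section \<open>Laws on the naturals as nonnegative sequences with sum 1\<close>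

lemma pmf_expectation_sums:
  fixes D :: "nat pmf" and f :: "nat \<Rightarrow> real"
  assumes "\<And>n. \<bar>f n\<bar> \<le> B"
  shows "(\<lambda>n. pmf D n * f n) sums measure_pmf.expectation D f"
proof -
  have "integrable (measure_pmf D) f"
    using assms by (intro measure_pmf.integrable_const_bound[where B = B]) auto
  then have "integrable (count_space UNIV) (\<lambda>n. pmf D n * f n)"
    unfolding measure_pmf_eq_density by (subst (asm) integrable_density) auto
  moreover have "measure_pmf.expectation D f = (\<integral>n. pmf D n * f n \<partial>count_space UNIV)"
    unfolding measure_pmf_eq_density by (subst integral_density) auto
  ultimately show ?thesis
    using sums_integral_count_space_nat by simp
qed

lemma pmf_sums_1:
  fixes D :: "nat pmf"
  shows "pmf D sums 1"
  using pmf_expectation_sums[of "\<lambda>_. 1" 1 D] by simp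

lemma pmf_of_sums:
  fixes f :: "nat \<Rightarrow> real"
  assumes "\<And>n. f n \<ge> 0" "f sums 1"
  obtains D where "\<And>n. pmf D n = f n"
proof -
  have "(\<integral>\<^sup>+n. ennreal (f n) \<partial>count_space UNIV) = ennreal 1"
    unfolding nn_integral_count_space_nat using assms by (intro suminf_ennreal_eq) auto
  then show thesis
    using that[of "embed_pmf f"] assms by (simp add: pmf_embed_pmf)
qed

section \<open>Convolution of laws and multiplication of generating functions\<close>

definition pmf_convolution :: "nat pmf \<Rightarrow> nat pmf \<Rightarrow> nat pmf" where
  "pmf_convolution A B = bind_pmf A (\<lambda>x. map_pmf ((+) x) B)"

lemma pmf_pmf_convolution:
  "pmf (pmf_convolution A B) n = (\<Sum>i\<le>n. pmf A i * pmf B (n - i))"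
proof -
  have eq: "pmf (map_pmf ((+) x) B) n = (if x \<le> n then pmf B (n - x) else 0)" for x
  proof (cases "x \<le> n")
    case True
    then show ?thesis
      using pmf_map_inj'[of "(+) x" B "n - x"] by simp
  next
    case False
    then show ?thesis
      by (auto simp: pmf_eq_0_set_pmf)
  qed
  show ?thesis
    unfolding pmf_convolution_def pmf_bind eq
    by (subst integral_measure_pmf_real[where A="{..n}"]) (auto intro!: sum.cong split: if_splits)
qed

text \<open>Links convolution of real measures, in terms of which infinite divisibility is defined,
  to Cauchy products of masses: the embedding \<open>real\<close> respects addition.\<close>

lemma convolution_distr_pmf:
  "convolution (distr (measure_pmf A) borel real) (distr (measure_pmf B) borel real)
     = distr (measure_pmf (pmf_convolution A B)) borel real"
proof (rule measure_eqI)
  fix S :: "real set"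
  assume "S \<in> sets (convolution (distr (measure_pmf A) borel real) (distr (measure_pmf B) borel real))"
  then have S [measurable]: "S \<in> sets borel"
    by simp
  interpret a: prob_space "distr (measure_pmf A) borel real"
    by (intro measure_pmf.prob_space_distr) simp
  interpret b: prob_space "distr (measure_pmf B) borel real"
    by (intro measure_pmf.prob_space_distr) simp
  have "emeasure (convolution (distr (measure_pmf A) borel real) (distr (measure_pmf B) borel real)) S
      = (\<integral>\<^sup>+x. \<integral>\<^sup>+y. indicator S (x + y) \<partial>distr (measure_pmf B) borel real \<partial>distr (measure_pmf A) borel real)"
    by (intro convolution_emeasure' S) (auto intro: a.finite_measure b.finite_measure)
  also have "\<dots> = (\<integral>\<^sup>+i. \<integral>\<^sup>+j. indicator S (real i + real j) \<partial>measure_pmf B \<partial>measure_pmf A)"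
    by (simp add: nn_integral_distr)
  also have "\<dots> = (\<integral>\<^sup>+i. emeasure (map_pmf ((+) i) B) (real -` S) \<partial>measure_pmf A)"
    by (intro nn_integral_cong)
      (simp add: nn_integral_indicator[symmetric] indicator_def del: nn_integral_indicator)
  also have "\<dots> = emeasure (distr (measure_pmf (pmf_convolution A B)) borel real) S"
    by (simp add: emeasure_distr pmf_convolution_def)
  finally show "emeasure (convolution (distr (measure_pmf A) borel real) (distr (measure_pmf B) borel real)) S
    = emeasure (distr (measure_pmf (pmf_convolution A B)) borel real) S" .
qed simp

text \<open>Convolution powers have the coefficients of the powers of the generating function as
  masses, so that a root of the generating function yields a convolution root. The power 0 is the
  point mass at 0, with generating function 1.\<close>

lemma convolution_power_distr_pmf:
  assumes g: "\<And>k. pmf D k = g $ k"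
  shows "\<exists>E. convolution_power (distr (measure_pmf D) borel real) n = distr (measure_pmf E) borel real
    \<and> (\<forall>k. pmf E k = (g ^ n) $ k)"
proof (induction n)
  case 0
  have "return borel 0 = distr (measure_pmf (return_pmf 0)) borel real"
    by (simp add: return_pmf.rep_eq distr_return)
  then show ?case
    by (auto intro!: exI[of _ "return_pmf 0"] simp: fps_one_nth)
next
  case (Suc n)
  then obtain E where "convolution_power (distr (measure_pmf D) borel real) n = distr (measure_pmf E) borel real"
    "\<forall>k. pmf E k = (g ^ n) $ k"
    by blast
  then show ?case
    by (intro exI[of _ "pmf_convolution D E"])
      (simp add: convolution_distr_pmf pmf_pmf_convolution g fps_mult_nth atLeast0AtMost)
qed

text \<open>The \<open>n\<close>-th root of the generating function has nonnegative coefficients by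
  log-convexity, and they sum to 1. It is thus the generating function of a law, whose
  \<open>n\<close>-fold convolution has the masses of \<open>D\<close>.\<close>

lemma log_convex_infinitely_divisible:
  fixes D :: "nat pmf"
  assumes pos: "\<And>n. pmf D n > 0"
    and convex: "\<And>n. pmf D (Suc n) * pmf D (Suc n) \<le> pmf D n * pmf D (Suc (Suc n))"
  shows "infinitely_divisible (distr (measure_pmf D) borel real)"
  unfolding infinitely_divisible_def
proof (intro conjI allI impI)
  show "real_distribution (distr (measure_pmf D) borel real)"
    by (intro prob_space.real_distribution_distr[OF measure_pmf.prob_space_axioms]) simp
  fix n :: nat
  assume n: "n \<ge> 1"
  define f where "f = Abs_fps (pmf D)"
  have f: "f $ k = pmf D k" for k
    by (simp add: f_def)
  have "(fps_deriv f * inverse f) $ k \<ge> 0" for k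
    using pos convex by (intro log_convex_imp_log_deriv_nonneg) (auto simp: f)
  then obtain g where g: "g ^ n = f" "g $ 0 > 0" "\<And>k. g $ k \<ge> 0"
    using fps_root_nonneg[of f n] pos n f by metis
  have "(pmf D) sums 1"
    by (rule pmf_sums_1)
  then have "(\<lambda>k. g $ k) sums 1"
    using g n by (intro fps_root_sums_1[of g n]) (auto simp: f)
  then obtain E where E: "\<And>k. pmf E k = g $ k"
    using pmf_of_sums[of "\<lambda>k. g $ k"] g by auto
  obtain E' where E': "convolution_power (distr (measure_pmf E) borel real) n = distr (measure_pmf E') borel real"
    "\<forall>k. pmf E' k = (g ^ n) $ k"
    using convolution_power_distr_pmf[of E g n] E by blast
  have "E' = D"
    using E' by (intro pmf_eqI) (simp add: g f)
  then show "\<exists>\<rho>. real_distribution \<rho> \<and> convolution_power \<rho> n = distr (measure_pmf D) borel real"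
    using E' by (intro exI[of _ "distr (measure_pmf E) borel real"])
      (auto intro!: prob_space.real_distribution_distr[OF measure_pmf.prob_space_axioms])
qed

section \<open>Laws on the natural numbers and the geometric law\<close>

lemma measure_Collect_distr:
  fixes X :: "'a \<Rightarrow> nat"
  assumes "X \<in> measurable M (count_space UNIV)"
  shows "measure M {\<omega> \<in> space M. Q (X \<omega>)} = measure (distr M (count_space UNIV) X) {n. Q n}"
  using assms by (subst measure_distr) (auto intro!: arg_cong[where f = "measure M"])

text \<open>On a countable space almost every point is an atom, so every law is a
  \<open>pmf\<close>; this reduces statements about random variables to their masses.\<close>

lemma nat_law_pmf:
  fixes X :: "'a \<Rightarrow> nat"
  assumes "prob_space M" "X \<in> measurable M (count_space UNIV)"
  obtains D where "distr M (count_space UNIV) X = measure_pmf D"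
proof -
  interpret D: prob_space "distr M (count_space UNIV) X"
    using assms by (rule prob_space.prob_space_distr)
  have "AE x in distr M (count_space UNIV) X. measure (distr M (count_space UNIV) X) {x} \<noteq> 0"
    by (subst D.AE_support_countable) (auto intro!: exI[of _ UNIV])
  then show thesis
    using that[of "Abs_pmf (distr M (count_space UNIV) X)"] D.prob_space_axioms
    by (simp add: Abs_pmf_inverse)
qed

lemma pmf_from_tails:
  fixes D :: "nat pmf"
  shows "pmf D 0 = 1 - measure D {0<..}"
    and "pmf D (Suc n) = measure D {n<..} - measure D {Suc n<..}"
proof -
  have "measure D (UNIV - {0<..}) = 1 - measure D {0<..}"
    using measure_pmf.prob_compl[of "{0<..}" D] by simp
  moreover have "UNIV - {0<..} = {0 :: nat}"
    by auto
  ultimately show "pmf D 0 = 1 - measure D {0<..}"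
    by (simp add: pmf.rep_eq)
  have "measure D ({n<..} - {Suc n<..}) = measure D {n<..} - measure D {Suc n<..}"
    by (intro measure_pmf.finite_measure_Diff) auto
  moreover have "{n<..} - {Suc n<..} = {Suc n}"
    by auto
  ultimately show "pmf D (Suc n) = measure D {n<..} - measure D {Suc n<..}"
    by (simp add: pmf.rep_eq)
qed

lemma pmf_eqI_tails:
  fixes D E :: "nat pmf"
  assumes "\<And>j. measure D {j<..} = measure E {j<..}"
  shows "D = E"
proof (rule pmf_eqI)
  fix n
  show "pmf D n = pmf E n"
    by (cases n) (simp_all add: pmf_from_tails assms)
qed

text \<open>The masses are differences of tails. The laws of both representations of
  \<open>\<nu>\<close> are identified through this criterion.\<close>

lemma nat_law_eqI:
  fixes X :: "'a \<Rightarrow> nat"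
  assumes "prob_space M" "X \<in> measurable M (count_space UNIV)"
    and "\<And>j. measure M {\<omega> \<in> space M. X \<omega> > j} = measure (measure_pmf D) {j<..}"
  shows "distr M (count_space UNIV) X = measure_pmf D"
proof -
  obtain E where E: "distr M (count_space UNIV) X = measure_pmf E"
    using nat_law_pmf assms by metis
  have "measure E {j<..} = measure D {j<..}" for j
    using assms(3)[of j] measure_Collect_distr[OF assms(2), of "\<lambda>n. n > j"]
    by (simp add: E greaterThan_def)
  then show ?thesis
    using E pmf_eqI_tails by metis
qed

lemma measure_atMost_pmf:
  fixes D :: "nat pmf"
  shows "measure D {..j} = 1 - measure D {j<..}"
  using measure_pmf.prob_compl[of "{j<..}" D] by (simp add: Compl_eq_Diff_UNIV[symmetric])

lemma infinitely_divisible_shifted: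
  fixes X :: "'a \<Rightarrow> nat"
  assumes X: "X \<in> measurable M (count_space UNIV)"
    and D: "distr M (count_space UNIV) X = measure_pmf D" and D0: "pmf D 0 = 0"
    and pos: "\<And>n. pmf D (Suc n) > 0"
    and convex: "\<And>n. pmf D (Suc (Suc n)) * pmf D (Suc (Suc n)) \<le> pmf D (Suc n) * pmf D (Suc (Suc (Suc n)))"
  shows "infinitely_divisible (distr M borel (\<lambda>\<omega>. real (X \<omega>) - 1))"
proof -
  \<comment> \<open>Truncated subtraction sends both 0 and 1 to 0, but \<open>D\<close> has no mass
    at 0, so \<open>E\<close> is \<open>D\<close> shifted down by one.\<close>
  define E where "E = map_pmf (\<lambda>n. n - 1) D"
  have "map_pmf Suc E = D"
    unfolding E_def map_pmf_comp
  proof (rule map_pmf_idI)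
    show "Suc (n - 1) = n" if "n \<in> set_pmf D" for n
      using that D0 by (cases n) (auto simp: set_pmf_iff)
  qed
  then have pmf: "pmf E n = pmf D (Suc n)" for n
    by (metis pmf_map_inj' inj_Suc)
  have "distr M borel (\<lambda>\<omega>. real (X \<omega>) - 1)
      = distr (distr M (count_space UNIV) X) borel (\<lambda>n. real n - 1)"
    using X by (subst distr_distr) (auto simp: comp_def)
  also have "\<dots> = distr (measure_pmf (map_pmf Suc E)) borel (\<lambda>n. real n - 1)"
    using \<open>map_pmf Suc E = D\<close> D by simp
  also have "\<dots> = distr (measure_pmf E) borel real"
    unfolding map_pmf_rep_eq by (subst distr_distr) (auto simp: comp_def)
  finally show ?thesis
    using log_convex_infinitely_divisible[of E] pos convex by (simp add: pmf)
qed

text \<open>For a single geometric sequence, \<open>k\<close> differences with the sign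
  \<open>(-1) ^ k\<close> multiply \<open>u ^ j\<close> by \<open>(1 - u) ^ k\<close>, which is
  nonnegative. Differences pass through the series, and the values lie between 0 and
  \<open>a 0\<close>.\<close>

lemma completely_monotone_mixture:
  fixes c u a :: "nat \<Rightarrow> real"
  assumes c: "\<And>m. c m \<ge> 0" and u: "\<And>m. u m \<in> {0..1}"
    and sums: "\<And>j. (\<lambda>m. c m * u m ^ j) sums a j" and a0: "a 0 \<le> 1"
  shows "completely_monotone a"
proof -
  have diff: "(\<lambda>m. c m * (1 - u m) ^ k * u m ^ j) sums ((-1) ^ k * (fwd_diff ^^ k) a j)" for j k
  proof (induction k arbitrary: j)
    case 0
    then show ?case using sums by simp
  next
    case (Suc k)
    show ?case
      using sums_diff[OF Suc[of j] Suc[of "Suc j"]] by (simp add: fwd_diff_def algebra_simps)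
  qed
  have nonneg: "0 \<le> (-1) ^ k * (fwd_diff ^^ k) a j" for j k
    using c u by (intro sums_le[OF _ sums_zero diff]) auto
  moreover have "a j \<in> {0..1}" for j
  proof -
    have "a j \<le> a 0"
      using c u by (intro sums_le[OF _ sums sums]) (auto simp: mult_left_le power_le_one)
    then show ?thesis
      using a0 nonneg[of 0 j] by simp
  qed
  ultimately show ?thesis
    by (simp add: completely_monotone_def)
qed

section \<open>Tails and generating function of the geometric law\<close>

lemma measure_geometric_tail:
  assumes "0 < p" "p < 1"
  shows "measure (map_pmf Suc (geometric_pmf p)) {j<..} = (1 - p) ^ j"
proof -
  have "measure (map_pmf Suc (geometric_pmf p)) {..j} = 1 - (1 - p) ^ j"
  proof (induction j)
    case 0
    then show ?case by (simp add: vimage_def)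
  next
    case (Suc j)
    have "measure (map_pmf Suc (geometric_pmf p)) {..Suc j}
        = measure (map_pmf Suc (geometric_pmf p)) {..j} + pmf (map_pmf Suc (geometric_pmf p)) (Suc j)"
      by (simp only: measure_measure_pmf_finite finite_atMost sum.atMost_Suc)
    also have "pmf (map_pmf Suc (geometric_pmf p)) (Suc j) = (1 - p) ^ j * p"
      using assms by (simp add: pmf_map_inj')
    finally show ?case
      using Suc by (simp add: algebra_simps)
  qed
  then show ?thesis
    by (simp only: measure_atMost_pmf)
qed

text \<open>The masses prescribed at the positive values already sum to 1, so nothing is left for 0.
  The map \<open>Suc\<close> appears because \<open>geometric_pmf\<close> starts at 0.\<close>

lemma geometric_rv_law:
  assumes p: "0 < p" "p < 1" and M: "prob_space M" and X: "geometric_rv M p X"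
  shows "distr M (count_space UNIV) X = measure_pmf (map_pmf Suc (geometric_pmf p))"
proof -
  have meas: "X \<in> measurable M (count_space UNIV)"
    using X by (simp add: geometric_rv_def)
  obtain D where D: "distr M (count_space UNIV) X = measure_pmf D"
    using nat_law_pmf M meas by metis
  have Suc: "pmf D (Suc k) = p * (1 - p) ^ k" for k
    using X measure_Collect_distr[OF meas, of "\<lambda>n. n = Suc k"]
    by (simp add: D geometric_rv_def pmf.rep_eq)
  have "(\<lambda>k. pmf D (Suc k)) sums (p * (1 / (1 - (1 - p))))"
    unfolding Suc using p by (intro sums_mult geometric_sums) auto
  then have "pmf D sums (1 + pmf D 0)"
    using sums_Suc[of "pmf D" 1] p by simp
  then have "pmf D 0 = 0"
    using pmf_sums_1[of D] sums_unique2 by fastforce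
  moreover have "pmf (map_pmf Suc (geometric_pmf p)) 0 = 0"
    by (auto simp: pmf_eq_0_set_pmf)
  ultimately have D0: "pmf D 0 = pmf (map_pmf Suc (geometric_pmf p)) 0"
    by simp
  have "D = map_pmf Suc (geometric_pmf p)"
  proof (rule pmf_eqI)
    fix n
    show "pmf D n = pmf (map_pmf Suc (geometric_pmf p)) n"
      using p Suc D0 by (cases n) (simp_all add: pmf_map_inj' mult.commute)
  qed
  then show ?thesis
    using D by simp
qed

lemma geometric_rv_prob:
  assumes "0 < p" "p < 1" "prob_space M" "geometric_rv M p X"
  shows "measure M {\<omega> \<in> space M. X \<omega> > j} = (1 - p) ^ j"
    and "measure M {\<omega> \<in> space M. X \<omega> \<le> j} = 1 - (1 - p) ^ j"
proof -
  have "X \<in> measurable M (count_space UNIV)"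
    using assms by (simp add: geometric_rv_def)
  from measure_Collect_distr[OF this]
  have law: "measure M {\<omega> \<in> space M. Q (X \<omega>)} = measure (map_pmf Suc (geometric_pmf p)) {n. Q n}" for Q
    using geometric_rv_law[OF assms] by simp
  show "measure M {\<omega> \<in> space M. X \<omega> > j} = (1 - p) ^ j"
    "measure M {\<omega> \<in> space M. X \<omega> \<le> j} = 1 - (1 - p) ^ j"
    using law[of "\<lambda>n. n > j"] law[of "\<lambda>n. n \<le> j"] measure_geometric_tail[OF assms(1,2), of j]
      measure_atMost_pmf[of "map_pmf Suc (geometric_pmf p)" j]
    by (simp_all only: greaterThan_def atMost_def)
qed

text \<open>Stated as a series, it serves both for the generating function of \<open>X\<close> and,
  at \<open>z = q ^ j\<close>, for the sum over the values of \<open>G\<close> in the representation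
  by a minimum.\<close>

lemma sums_pgf_geometric:
  assumes p: "0 < p" "p < 1" and z: "0 \<le> z" "z \<le> 1"
  shows "(\<lambda>n. pmf (map_pmf Suc (geometric_pmf p)) n * z ^ n) sums (p * z / (1 - (1 - p) * z))"
proof -
  have "(1 - p) * z < 1"
    using p z by (smt (verit) mult_left_le)
  then have "(\<lambda>n. p * z * ((1 - p) * z) ^ n) sums (p * z * (1 / (1 - (1 - p) * z)))"
    using p z by (intro sums_mult geometric_sums) (auto simp: abs_mult)
  then have "(\<lambda>n. pmf (map_pmf Suc (geometric_pmf p)) (Suc n) * z ^ Suc n) sums (p * z / (1 - (1 - p) * z))"
    using p by (simp add: pmf_map_inj' power_mult_distrib mult_ac)
  moreover have "pmf (map_pmf Suc (geometric_pmf p)) 0 = 0"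
    by (auto simp: pmf_eq_0_set_pmf)
  ultimately show ?thesis
    using sums_Suc[of "\<lambda>n. pmf (map_pmf Suc (geometric_pmf p)) n * z ^ n"] by simp
qed

lemma pgf_geometric:
  assumes p: "0 < p" "p < 1" and M: "prob_space M" and X: "geometric_rv M p X"
    and z: "0 \<le> z" "z \<le> 1"
  shows "pgf M X z = p * z / (1 - (1 - p) * z)"
proof -
  let ?D = "map_pmf Suc (geometric_pmf p)"
  have "X \<in> measurable M (count_space UNIV)"
    using X by (simp add: geometric_rv_def)
  then have "pgf M X z = (\<integral>n. z ^ n \<partial>distr M (count_space UNIV) X)"
    unfolding pgf_def by (subst integral_distr) auto
  also have "\<dots> = measure_pmf.expectation ?D (\<lambda>n. z ^ n)"
    by (simp only: geometric_rv_law[OF p M X])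
  finally show ?thesis
    using pmf_expectation_sums[of "\<lambda>n. z ^ n" 1 ?D] sums_pgf_geometric[OF p z] z
      sums_unique2[of "\<lambda>n. pmf ?D n * z ^ n"]
    by (simp add: power_le_one)
qed

text \<open>With the closed form of the generating function and the denominators cleared, the
  equation is linear in \<open>z\<close>. Being an equivalence, it gives both existence and
  uniqueness of the solution.\<close>

lemma functional_equation_iff:
  assumes p: "0 < p" "p < 1" "q = 1 - p" and M: "prob_space M" and X: "geometric_rv M p X"
    and z: "0 \<le> z" "z \<le> 1"
  shows "measure M {\<omega> \<in> space M. X \<omega> \<le> j} = pgf M X z \<longleftrightarrow> z = (1 - q ^ j) / (1 - q ^ (j + 1))"
proof -
  have "q * z < 1"
    using p z by (smt (verit) mult_left_le)
  moreover have "q ^ (j + 1) < 1"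
    using p by (simp add: power_less_one_iff del: power_Suc)
  moreover have "(1 - q ^ j) * (1 - q * z) = (1 - q) * z \<longleftrightarrow> z * (1 - q ^ (j + 1)) = 1 - q ^ j"
    by (auto simp: algebra_simps)
  moreover have "1 - p = q" "p = 1 - q"
    using p by auto
  ultimately show ?thesis
    by (simp add: geometric_rv_prob[OF p(1,2) M X] pgf_geometric[OF p(1,2) M X z] eq_divide_eq)
qed

section \<open>The law of the branching number\<close>

context
  fixes p q :: real
  assumes p: "0 < p" "p < 1" and q: "q = 1 - p"
begin

text \<open>Complement of the solution of the functional equation. The tail is a function of its own
  so that it can be studied before any \<open>\<nu>\<close> with this tail is given.\<close>

definition branching_tail :: "nat \<Rightarrow> real" where
  "branching_tail j = p * q ^ j / (1 - q ^ Suc j)"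

lemma q_bounds: "0 < q" "q < 1"
  using p q by auto

lemma p_eq: "p = 1 - q"
  using q by simp

lemma q_power_less_1: "q ^ Suc j < 1"
  using q_bounds power_less_one_iff[of q "Suc j"] by simp

lemma branching_tail_0: "branching_tail 0 = 1"
  unfolding branching_tail_def using p q by simp

lemma branching_tail_pos: "branching_tail j > 0"
  using p q_bounds q_power_less_1[of j] by (auto simp: branching_tail_def intro!: divide_pos_pos)

lemma branching_tail_compl: "1 - branching_tail j = (1 - q ^ j) / (1 - q ^ (j + 1))"
  unfolding branching_tail_def using q_power_less_1[of j] by (simp add: p_eq field_simps)

text \<open>This is the mass at \<open>Suc j\<close>. Over the common denominator the terms with
  \<open>q ^ (2 * j + 2)\<close> cancel, which leaves \<open>p * q ^ j * (1 - q)\<close>.\<close>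

lemma branching_tail_diff:
  "branching_tail j - branching_tail (Suc j) = p\<^sup>2 * q ^ j / ((1 - q ^ Suc j) * (1 - q ^ Suc (Suc j)))"
proof -
  have "1 - q ^ Suc j \<noteq> 0" "1 - q ^ Suc (Suc j) \<noteq> 0"
    using q_power_less_1[of j] q_power_less_1[of "Suc j"] by auto
  moreover have "p * q ^ j * (1 - q ^ Suc (Suc j)) - p * q ^ Suc j * (1 - q ^ Suc j) = p\<^sup>2 * q ^ j"
    by (simp add: q power2_eq_square algebra_simps)
  ultimately show ?thesis
    unfolding branching_tail_def by (simp add: diff_frac_eq del: power_Suc)
qed

lemma branching_tail_ratio_tendsto: "(\<lambda>j. branching_tail j / q ^ j) \<longlonglongrightarrow> p"
proof -
  have "(\<lambda>j. p / (1 - q ^ Suc j)) \<longlonglongrightarrow> p / (1 - 0)"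
    using q_bounds by (intro tendsto_intros LIMSEQ_Suc LIMSEQ_power_zero) auto
  moreover have "branching_tail j / q ^ j = p / (1 - q ^ Suc j)" for j
    using q_bounds by (simp add: branching_tail_def)
  ultimately show ?thesis
    by simp
qed

lemma branching_tail_tendsto_0: "branching_tail \<longlonglongrightarrow> 0"
proof -
  have "(\<lambda>j. branching_tail j / q ^ j * q ^ j) \<longlonglongrightarrow> p * 0"
    using q_bounds by (intro tendsto_mult branching_tail_ratio_tendsto LIMSEQ_power_zero) auto
  then show ?thesis
    using q_bounds by simp
qed

lemma completely_monotone_branching_tail: "completely_monotone branching_tail"
proof (rule completely_monotone_mixture)
  fix j m
  show "p * q ^ m \<ge> 0" "q ^ Suc m \<in> {0..1}"
    using p q_bounds by (auto intro!: mult_le_one power_le_one)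
  have "(\<lambda>m. p * q ^ j * (q ^ Suc j) ^ m) sums (p * q ^ j * (1 / (1 - q ^ Suc j)))"
    using q_bounds q_power_less_1[of j] by (intro sums_mult geometric_sums) (simp add: abs_mult power_abs)
  \<comment> \<open>Both exponents of \<open>q\<close> equal \<open>j + m + j * m\<close>, so the
    mixture is a geometric series in \<open>m\<close>.\<close>
  moreover have "p * q ^ m * (q ^ Suc m) ^ j = p * q ^ j * (q ^ Suc j) ^ m" for m
    by (simp add: power_mult[symmetric] power_add[symmetric] power_mult_distrib algebra_simps)
  ultimately show "(\<lambda>m. p * q ^ m * (q ^ Suc m) ^ j) sums branching_tail j"
    by (simp only: branching_tail_def mult_1_right times_divide_eq_right)
qed (simp add: branching_tail_0)

text \<open>The decrements of the tail serve as masses. They telescope to total mass 1, since the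
  tail starts at 1 and tends to 0.\<close>

lemma exists_branching_pmf: "\<exists>D :: nat pmf. \<forall>j. measure D {j<..} = branching_tail j"
proof -
  define f where "f n = (if n = 0 then 0 else branching_tail (n - 1) - branching_tail n)" for n
  have "f n \<ge> 0" for n
  proof (cases n)
    case (Suc m)
    then show ?thesis
      using p q_bounds q_power_less_1[of m] q_power_less_1[of "Suc m"]
      by (auto simp: f_def branching_tail_diff simp del: power_Suc intro!: divide_nonneg_nonneg mult_nonneg_nonneg)
  qed (simp add: f_def)
  moreover have "(\<lambda>n. f (Suc n)) sums (branching_tail 0 - 0)"
    unfolding f_def using telescope_sums'[OF branching_tail_tendsto_0] by simp
  then have "f sums 1"
    using sums_Suc[of f "branching_tail 0"] by (simp add: branching_tail_0 f_def)
  ultimately obtain D where D: "\<And>n. pmf D n = f n"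
    using pmf_of_sums by blast
  have "measure D {..j} = 1 - branching_tail j" for j
  proof (induction j)
    case 0
    then show ?case by (simp add: measure_measure_pmf_finite D f_def branching_tail_0)
  next
    case (Suc j)
    then show ?case by (simp add: measure_measure_pmf_finite D f_def)
  qed
  then show ?thesis
    by (auto simp: measure_atMost_pmf)
qed

section \<open>Masses, log-convexity and failure rate of the branching law\<close>

context
  fixes D :: "nat pmf"
  assumes D: "\<And>j. measure D {j<..} = branching_tail j"
begin

lemma branching_pmf_0: "pmf D 0 = 0"
  by (simp add: pmf_from_tails D branching_tail_0)

lemma branching_pmf_Suc:
  "pmf D (Suc j) = p\<^sup>2 * q ^ j / ((1 - q ^ Suc j) * (1 - q ^ Suc (Suc j)))"
  by (simp only: pmf_from_tails D branching_tail_diff)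

lemma branching_pmf_Suc_pos: "pmf D (Suc j) > 0"
  using p q_bounds q_power_less_1[of j] q_power_less_1[of "Suc j"]
  by (auto simp: branching_pmf_Suc simp del: power_Suc intro!: divide_pos_pos mult_pos_pos)

text \<open>Three successive masses have denominators \<open>a * b\<close>, \<open>b * c\<close>,
  \<open>c * d\<close>, and their numerators are in geometric progression. The claim thus reduces to
  \<open>a * d \<le> b * c\<close>, which an explicit factorization of the difference shows.\<close>

lemma branching_pmf_log_convex:
  "pmf D (Suc (Suc j)) * pmf D (Suc (Suc j)) \<le> pmf D (Suc j) * pmf D (Suc (Suc (Suc j)))"
proof -
  define a b c d where abcd: "a = 1 - q ^ Suc j" "b = 1 - q ^ Suc (Suc j)"
    "c = 1 - q ^ Suc (Suc (Suc j))" "d = 1 - q ^ Suc (Suc (Suc (Suc j)))"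
  have pos: "a > 0" "b > 0" "c > 0" "d > 0"
    using q_power_less_1 by (simp_all only: abcd diff_gt_0_iff_gt)
  define x where "x = q ^ Suc j"
  have x: "0 < x"
    using q_bounds by (simp add: x_def)
  have "b * c - a * d = x * (1 - q) * (1 - q\<^sup>2)"
    by (simp add: abcd x_def power2_eq_square algebra_simps)
  moreover have "x * (1 - q) * (1 - q\<^sup>2) \<ge> 0"
    using q_bounds x by (intro mult_nonneg_nonneg) (auto simp: power_le_one)
  ultimately have "a * d \<le> b * c"
    by simp
  then have "(p\<^sup>2 * q ^ Suc j)\<^sup>2 / ((b * c) * (b * c)) \<le> (p\<^sup>2 * q ^ Suc j)\<^sup>2 / ((b * c) * (a * d))"
    using pos by (intro divide_left_mono mult_left_mono) auto
  also have "\<dots> = (p\<^sup>2 * q ^ j / (a * b)) * (p\<^sup>2 * q ^ Suc (Suc j) / (c * d))"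
    using pos by (simp add: field_simps power2_eq_square)
  finally show ?thesis
    unfolding branching_pmf_Suc abcd[symmetric] by (simp add: power2_eq_square)
qed

text \<open>The rate at the value \<open>Suc j\<close>, since exceeding \<open>j\<close> means being
  at least \<open>Suc j\<close>. The denominator of the tail cancels one factor of that of the
  mass.\<close>

lemma branching_failure_rate:
  "pmf D (Suc j) / measure D {j<..} = p / (1 - q ^ Suc (Suc j))"
  using p q_bounds q_power_less_1[of j] q_power_less_1[of "Suc j"]
  unfolding branching_pmf_Suc D branching_tail_def
  by (simp add: power2_eq_square del: power_Suc)

end

section \<open>The waiting time for the first success in independent trials\<close>

lemma Bernoulli_waiting_time_tail:
  fixes P :: "'c measure" and B :: "nat \<Rightarrow> 'c \<Rightarrow> bool"
  assumes P: "prob_space P"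
    and ind: "prob_space.indep_vars P (\<lambda>_. count_space UNIV) B {1..}"
    and B: "\<And>i. i \<ge> 1 \<Longrightarrow> distr P (count_space UNIV) (B i)
      = measure_pmf (bernoulli_pmf (1 / (\<Sum>k\<le>i. q ^ k)))"
  shows "measure P {\<omega> \<in> space P. \<forall>i\<in>{1..j}. \<not> B i \<omega>} = branching_tail j"
proof -
  interpret prob_space P by fact
  have meas: "B i \<in> measurable P (count_space UNIV)" if "i \<ge> 1" for i
    using ind that by (auto simp: indep_vars_def)
  \<comment> \<open>The failure probability \<open>1 - \<alpha>_i\<close>, written as a quotient of
    consecutive values of \<open>1 - q ^ i\<close> so that the product over \<open>i\<close>
    telescopes.\<close>
  have fail: "prob (B i -` {False} \<inter> space P) = q * (1 - q ^ i) / (1 - q ^ Suc i)" if i: "i \<ge> 1" for i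
  proof -
    have "(\<Sum>k\<le>i. q ^ k) = (1 - q ^ Suc i) / (1 - q)"
      using q_bounds by (simp add: sum_gp0)
    then have \<alpha>: "1 / (\<Sum>k\<le>i. q ^ k) = p / (1 - q ^ Suc i)"
      using q by simp
    \<comment> \<open>Hence \<open>p = 1 - q\<close> is at most \<open>1 - q ^ Suc i\<close>, and
      the success parameter is a probability.\<close>
    have "q ^ Suc i \<le> q"
      using q_bounds by (simp add: mult_le_cancel_left1 power_le_one)
    then have bounds: "0 \<le> p / (1 - q ^ Suc i)" "p / (1 - q ^ Suc i) \<le> 1"
      using p q q_power_less_1[of i] by (auto simp del: power_Suc)
    have "prob (B i -` {False} \<inter> space P) = measure (distr P (count_space UNIV) (B i)) {False}"
      using meas[OF i] by (simp add: measure_distr)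
    also have "\<dots> = 1 - p / (1 - q ^ Suc i)"
      using bounds unfolding B[OF i] \<alpha> by (simp add: measure_pmf_single del: power_Suc)
    also have "\<dots> = q * (1 - q ^ i) / (1 - q ^ Suc i)"
      using q q_power_less_1[of i] by (simp add: field_simps)
    finally show ?thesis .
  qed
  show ?thesis
  \<comment> \<open>The product formula for independent events is applied to a nonempty index set;
    for \<open>j = 0\<close> the event is the whole space.\<close>
  proof (cases "j = 0")
    case True
    then show ?thesis using prob_space by (simp add: branching_tail_0)
  next
    case False
    have "{\<omega> \<in> space P. \<forall>i\<in>{1..j}. \<not> B i \<omega>} = (\<Inter>i\<in>{1..j}. B i -` {False} \<inter> space P)"
      using False by auto
    then have "prob {\<omega> \<in> space P. \<forall>i\<in>{1..j}. \<not> B i \<omega>} = (\<Prod>i=1..j. prob (B i -` {False} \<inter> space P))"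
      using False indep_varsD[OF ind, of "{1..j}" "\<lambda>_. {False}"] by auto
    also have "\<dots> = (\<Prod>i=1..j. q * (1 - q ^ i) / (1 - q ^ Suc i))"
      by (intro prod.cong refl fail) auto
    also have "\<dots> = branching_tail j"
    proof (induction j)
      case 0
      then show ?case by (simp add: branching_tail_0)
    next
      case (Suc j)
      have "(\<Prod>i=1..Suc j. q * (1 - q ^ i) / (1 - q ^ Suc i))
          = branching_tail j * (q * (1 - q ^ Suc j) / (1 - q ^ Suc (Suc j)))"
        using Suc by simp
      also have "\<dots> = branching_tail (Suc j)"
      proof -
        have "x / a * (q * a / b) = q * x / b" if "a \<noteq> 0" for x a b
          using that by simp
        moreover have "1 - q ^ Suc j \<noteq> 0"
          using q_power_less_1[of j] by simp
        ultimately show ?thesis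
          by (simp add: branching_tail_def mult_ac)
      qed
      finally show ?case .
    qed
    finally show ?thesis .
  qed
qed

text \<open>The infimum is taken in \<open>enat\<close>, where it is infinite if no trial succeeds.
  That event is null because the tails tend to 0, and off it the infimum is the least success index,
  whose law is determined by its tails.\<close>

lemma Bernoulli_waiting_time_law:
  fixes P :: "'c measure" and B :: "nat \<Rightarrow> 'c \<Rightarrow> bool" and D :: "nat pmf"
  assumes D: "\<And>j. measure D {j<..} = branching_tail j"
    and P: "prob_space P"
    and ind: "prob_space.indep_vars P (\<lambda>_. count_space UNIV) B {1..}"
    and B: "\<And>i. i \<ge> 1 \<Longrightarrow> distr P (count_space UNIV) (B i)
      = measure_pmf (bernoulli_pmf (1 / (\<Sum>k\<le>i. q ^ k)))"
  shows "distr P (count_space UNIV) (\<lambda>\<omega>. Inf (enat ` {i. 1 \<le> i \<and> B i \<omega>}))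
    = distr (measure_pmf D) (count_space UNIV) enat"
proof -
  interpret prob_space P by fact
  have B_meas: "B i \<in> measurable P (count_space UNIV)" if "i \<ge> 1" for i
    using ind that by (auto simp: indep_vars_def)
  \<comment> \<open>Setting the trial with index 0 to failure lets the least success index range
    over all naturals.\<close>
  define A where "A i \<omega> \<longleftrightarrow> 1 \<le> i \<and> B i \<omega>" for i \<omega>
  have [measurable]: "A i \<in> measurable P (count_space UNIV)" for i
    unfolding A_def by (cases "i \<ge> 1") (simp_all add: B_meas)
  define W where "W \<omega> = (LEAST i. A i \<omega>)" for \<omega>
  have W [measurable]: "W \<in> measurable P (count_space UNIV)"
    unfolding W_def by measurable
  have Inf_eq: "Inf (enat ` {i. A i \<omega>}) = (if \<exists>i. A i \<omega> then enat (W \<omega>) else \<infinity>)" for \<omega>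
  proof (cases "\<exists>i. A i \<omega>")
    case True
    then have "A (W \<omega>) \<omega>"
      unfolding W_def by (rule LeastI_ex)
    then have "Inf (enat ` {i. A i \<omega>}) = enat (W \<omega>)"
      by (intro antisym Inf_lower Inf_greatest) (auto simp: W_def intro: Least_le)
    then show ?thesis
      using True by simp
  next
    case False
    then have "{i. A i \<omega>} = {}"
      by blast
    then show ?thesis
      using False by (simp add: Inf_enat_def del: Collect_empty_eq)
  qed
  have set: "{\<omega> \<in> space P. \<not> (\<exists>i. A i \<omega>)} \<in> events"
    by measurable
  have set': "{\<omega> \<in> space P. \<forall>i\<in>{1..j}. \<not> A i \<omega>} \<in> events" for j
    by measurable
  have tail: "prob {\<omega> \<in> space P. \<forall>i\<in>{1..j}. \<not> A i \<omega>} = branching_tail j" for j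
  proof -
    have "(\<forall>i\<in>{1..j}. \<not> A i \<omega>) \<longleftrightarrow> (\<forall>i\<in>{1..j}. \<not> B i \<omega>)" for \<omega>
      by (auto simp: A_def)
    then show ?thesis
      by (simp only: Bernoulli_waiting_time_tail[OF P ind B])
  qed
  \<comment> \<open>Never succeeding implies failing in the first \<open>j\<close> trials, for every
    \<open>j\<close>.\<close>
  have "prob {\<omega> \<in> space P. \<not> (\<exists>i. A i \<omega>)} \<le> branching_tail j" for j
    unfolding tail[symmetric] using set' by (intro finite_measure_mono) auto
  then have "prob {\<omega> \<in> space P. \<not> (\<exists>i. A i \<omega>)} \<le> 0"
    by (intro LIMSEQ_le_const[OF branching_tail_tendsto_0]) auto
  then have "prob {\<omega> \<in> space P. \<not> (\<exists>i. A i \<omega>)} = 0"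
    using measure_nonneg[of P] by (intro antisym) auto
  then have AE: "AE \<omega> in P. \<exists>i. A i \<omega>"
    using set by (intro AE_I[of _ _ "{\<omega> \<in> space P. \<not> (\<exists>i. A i \<omega>)}"]) (auto simp: emeasure_eq_measure)
  have "prob {\<omega> \<in> space P. W \<omega> > j} = branching_tail j" for j
    unfolding tail[symmetric]
  proof (rule measure_eq_AE)
    show "AE \<omega> in P. \<omega> \<in> {\<omega> \<in> space P. W \<omega> > j} \<longleftrightarrow> \<omega> \<in> {\<omega> \<in> space P. \<forall>i\<in>{1..j}. \<not> A i \<omega>}"
      using AE
    proof eventually_elim
      case (elim \<omega>)
      then have "A (W \<omega>) \<omega>"
        unfolding W_def by (rule LeastI_ex)
      moreover have "W \<omega> \<le> i" if "A i \<omega>" for i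
        using that by (auto simp: W_def intro: Least_le)
      ultimately show ?case
        by (force simp: A_def not_le[symmetric])
    qed
  qed (use set' in auto)
  then have law: "distr P (count_space UNIV) W = measure_pmf D"
    by (intro nat_law_eqI prob_space_axioms W) (simp add: D)
  have "distr P (count_space UNIV) (\<lambda>\<omega>. Inf (enat ` {i. A i \<omega>}))
      = distr P (count_space UNIV) (\<lambda>\<omega>. enat (W \<omega>))"
  proof (rule distr_cong_AE)
    show "AE \<omega> in P. Inf (enat ` {i. A i \<omega>}) = enat (W \<omega>)"
      using AE by eventually_elim (simp only: Inf_eq if_True)
  qed (unfold Inf_eq, measurable)
  also have "\<dots> = distr (distr P (count_space UNIV) W) (count_space UNIV) enat"
    by (subst distr_distr) (auto simp: comp_def)
  finally show ?thesis
    by (simp only: law A_def)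
qed

section \<open>The minimum of a geometric number of geometric variables\<close>

lemma geometric_minimum_law:
  fixes P :: "'d measure" and G :: "'d \<Rightarrow> nat" and \<xi> :: "nat \<Rightarrow> 'd \<Rightarrow> nat" and D :: "nat pmf"
  assumes D: "\<And>j. measure D {j<..} = branching_tail j"
    and P: "prob_space P" and G: "geometric_rv P p G"
    and \<xi>: "\<And>i. i \<ge> 1 \<Longrightarrow> geometric_rv P p (\<xi> i)"
    and ind: "prob_space.indep_vars P (\<lambda>_. count_space UNIV) \<xi> {1..}"
    and ind': "prob_space.indep_rvs P (count_space UNIV) G
      (Pi\<^sub>M {1..} (\<lambda>_. count_space UNIV)) (\<lambda>\<omega>. \<lambda>i\<in>{1..}. \<xi> i \<omega>)"
  shows "distr P (count_space UNIV) (\<lambda>\<omega>. Min ((\<lambda>i. \<xi> i \<omega>) ` {1..G \<omega>})) = measure_pmf D"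
proof -
  interpret prob_space P by fact
  let ?G = "map_pmf Suc (geometric_pmf p)"
  define Z where "Z \<omega> = Min ((\<lambda>i. \<xi> i \<omega>) ` {1..G \<omega>})" for \<omega>
  have G_meas [measurable]: "G \<in> measurable P (count_space UNIV)"
    using G by (simp add: geometric_rv_def)
  have \<xi>_meas: "\<xi> i \<in> measurable P (count_space UNIV)" if "i \<ge> 1" for i
    using \<xi>[OF that] by (simp add: geometric_rv_def)
  \<comment> \<open>Measurability is first shown for a fixed number of variables; the random number
    \<open>G\<close> is then inserted, as it takes countably many values.\<close>
  have fixed: "(\<lambda>\<omega>. Min ((\<lambda>i. \<xi> i \<omega>) ` {1..n})) \<in> measurable P (count_space UNIV)" for n
  proof (induction n)
    case 0
    then show ?case by simp
  next
    case (Suc n)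
    show ?case
    proof (cases "n = 0")
      case True
      then show ?thesis using \<xi>_meas[of 1] by simp
    next
      case False
      have "(\<lambda>\<omega>. min i (Min ((\<lambda>i. \<xi> i \<omega>) ` {1..n}))) \<in> measurable P (count_space UNIV)" for i
        by (rule measurable_compose[OF Suc.IH]) simp
      from measurable_compose_countable[OF this, of "\<xi> (Suc n)"]
      have "(\<lambda>\<omega>. min (\<xi> (Suc n) \<omega>) (Min ((\<lambda>i. \<xi> i \<omega>) ` {1..n}))) \<in> measurable P (count_space UNIV)"
        by (simp add: \<xi>_meas)
      moreover
      have "Min ((\<lambda>i. \<xi> i \<omega>) ` {1..Suc n}) = min (\<xi> (Suc n) \<omega>) (Min ((\<lambda>i. \<xi> i \<omega>) ` {1..n}))" for \<omega>
        using False by (simp add: atLeastAtMostSuc_conv)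
      ultimately show ?thesis
        by (simp only:)
    qed
  qed
  have Z [measurable]: "Z \<in> measurable P (count_space UNIV)"
    unfolding Z_def by (rule measurable_compose_countable[OF fixed G_meas])
  have \<xi>_tail: "prob {\<omega> \<in> space P. \<forall>i\<in>{1..n}. \<xi> i \<omega> > j} = (q ^ j) ^ n" for n j
  proof (cases "n = 0")
    case True
    then show ?thesis using prob_space by simp
  next
    case False
    have "{\<omega> \<in> space P. \<forall>i\<in>{1..n}. \<xi> i \<omega> > j} = (\<Inter>i\<in>{1..n}. \<xi> i -` {j<..} \<inter> space P)"
      using False by auto
    then have "prob {\<omega> \<in> space P. \<forall>i\<in>{1..n}. \<xi> i \<omega> > j} = (\<Prod>i=1..n. prob (\<xi> i -` {j<..} \<inter> space P))"
      using False indep_varsD[OF ind, of "{1..n}" "\<lambda>_. {j<..}"] by auto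
    also have "\<dots> = (\<Prod>i=1..n. q ^ j)"
    proof (intro prod.cong refl)
      fix i assume "i \<in> {1..n}"
      then have "prob {\<omega> \<in> space P. \<xi> i \<omega> > j} = q ^ j"
        using geometric_rv_prob(1)[OF p P \<xi>] q by simp
      then show "prob (\<xi> i -` {j<..} \<inter> space P) = q ^ j"
        by (simp add: vimage_def Int_def conj_commute)
    qed
    finally show ?thesis by simp
  qed
  have G_prob: "prob {\<omega> \<in> space P. G \<omega> = n} = pmf ?G n" for n
    using measure_Collect_distr[OF G_meas, of "\<lambda>k. k = n"]
    by (simp only: geometric_rv_law[OF p P G]) (simp add: pmf.rep_eq)
  have "prob {\<omega> \<in> space P. Z \<omega> > j} = branching_tail j" for j
  proof -
    \<comment> \<open>The tail event of the minimum is split according to the value of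
      \<open>G\<close>.\<close>
    define A where "A n = {\<omega> \<in> space P. G \<omega> = n \<and> Z \<omega> > j}" for n
    have A: "A n \<in> events" for n
      unfolding A_def by measurable
    have "(\<lambda>n. prob (A n)) sums prob (\<Union>n. A n)"
      using A by (intro finite_measure_UNION) (auto simp: disjoint_family_on_def A_def)
    moreover have "(\<Union>n. A n) = {\<omega> \<in> space P. Z \<omega> > j}"
      by (auto simp: A_def)
    moreover have "prob (A n) = pmf ?G n * (q ^ j) ^ n" for n
    proof (cases "n = 0")
      case True
      \<comment> \<open>For \<open>n = 0\<close> the minimum is over the empty set and has no useful
        value, but \<open>G = 0\<close> is a null event.\<close>
      have "prob (A n) \<le> prob {\<omega> \<in> space P. G \<omega> = n}"
        by (intro finite_measure_mono) (auto simp: A_def)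
      also have "\<dots> = 0"
        unfolding G_prob True by (auto simp: pmf_eq_0_set_pmf)
      finally have "prob (A n) = 0"
        using measure_nonneg[of P "A n"] by linarith
      moreover have "pmf ?G n = 0"
        unfolding True by (auto simp: pmf_eq_0_set_pmf)
      ultimately show ?thesis
        by simp
    next
      case False
      let ?F = "Pi\<^sub>M {1..} (\<lambda>_. count_space UNIV) :: (nat \<Rightarrow> nat) measure"
      \<comment> \<open>The event that the first \<open>n\<close> variables exceed \<open>j\<close>
        has to be a preimage of a set in the product sigma-algebra, since independence of
        \<open>G\<close> from the whole sequence is expressed by such preimages.\<close>
      define S where "S = {f \<in> space ?F. \<forall>i\<in>{1..n}. f i > j}"
      have "{f \<in> space ?F. f i > j} \<in> sets ?F" if "i \<in> {1..n}" for i
      proof -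
        have [measurable]: "(\<lambda>f. f i) \<in> measurable ?F (count_space UNIV)"
          using that by (intro measurable_component_singleton) auto
        show ?thesis
          by measurable
      qed
      then have S: "S \<in> sets ?F"
        unfolding S_def using False by (intro sets.sets_Collect_finite_All') auto
      have "A n = {\<omega> \<in> space P. G \<omega> = n} \<inter> {\<omega> \<in> space P. \<forall>i\<in>{1..n}. \<xi> i \<omega> > j}"
        using False by (auto simp: A_def Z_def)
      also have "prob \<dots> = prob {\<omega> \<in> space P. G \<omega> = n} * prob {\<omega> \<in> space P. \<forall>i\<in>{1..n}. \<xi> i \<omega> > j}"
      proof (rule indep_setD)
        show "indep_set {G -` A \<inter> space P | A. A \<in> sets (count_space UNIV)}
            {(\<lambda>\<omega>. \<lambda>i\<in>{1..}. \<xi> i \<omega>) -` A \<inter> space P | A. A \<in> sets ?F}"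
          using ind' by (simp add: indep_rvs_def)
        show "{\<omega> \<in> space P. G \<omega> = n} \<in> {G -` A \<inter> space P | A. A \<in> sets (count_space UNIV)}"
          by (auto intro!: exI[of _ "{n}"])
        have "{\<omega> \<in> space P. \<forall>i\<in>{1..n}. \<xi> i \<omega> > j} = (\<lambda>\<omega>. \<lambda>i\<in>{1..}. \<xi> i \<omega>) -` S \<inter> space P"
          by (auto simp: S_def space_PiM)
        then show "{\<omega> \<in> space P. \<forall>i\<in>{1..n}. \<xi> i \<omega> > j}
            \<in> {(\<lambda>\<omega>. \<lambda>i\<in>{1..}. \<xi> i \<omega>) -` A \<inter> space P | A. A \<in> sets ?F}"
          using S by blast
      qed
      finally show ?thesis
        by (simp only: \<xi>_tail G_prob)
    qed
    ultimately have "(\<lambda>n. pmf ?G n * (q ^ j) ^ n) sums prob {\<omega> \<in> space P. Z \<omega> > j}"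
      by simp
    \<comment> \<open>The series is the generating function of \<open>G\<close> at
      \<open>q ^ j\<close>.\<close>
    moreover have "(\<lambda>n. pmf ?G n * (q ^ j) ^ n) sums (p * q ^ j / (1 - (1 - p) * q ^ j))"
      using p q_bounds by (intro sums_pgf_geometric) (auto simp: power_le_one)
    ultimately have "prob {\<omega> \<in> space P. Z \<omega> > j} = p * q ^ j / (1 - (1 - p) * q ^ j)"
      by (rule sums_unique2)
    then show ?thesis
      unfolding branching_tail_def by (simp add: q)
  qed
  then have "distr P (count_space UNIV) Z = measure_pmf D"
    by (intro nat_law_eqI P Z) (simp add: D)
  then show ?thesis
    unfolding Z_def .
qed

end

section \<open>From the functional equation to the law of the branching number and its
  properties\<close>

lemma branching_number_law:
  assumes p: "0 < p" "p < 1" and q: "q = 1 - p"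
    and M: "prob_space M" and X: "geometric_rv M p X"
    and N: "branching_number M X N \<nu>"
  obtains D where "distr N (count_space UNIV) \<nu> = measure_pmf D"
    "\<And>j. measure D {j<..} = branching_tail p q j"
proof -
  have meas: "\<nu> \<in> measurable N (count_space UNIV)" and "prob_space N"
    and pos: "AE \<omega> in N. 1 \<le> \<nu> \<omega>"
    and eq: "\<And>j. j \<ge> 1 \<Longrightarrow> measure M {\<omega> \<in> space M. X \<omega> \<le> j} = pgf M X (measure N {\<omega> \<in> space N. \<nu> \<omega> \<le> j})"
    using N by (auto simp: branching_number_def)
  interpret N: prob_space N by fact
  obtain D where D: "distr N (count_space UNIV) \<nu> = measure_pmf D"
    using nat_law_pmf[OF N.prob_space_axioms meas] by metis
  have cdf: "measure N {\<omega> \<in> space N. \<nu> \<omega> \<le> j} = 1 - measure D {j<..}" for j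
    using measure_Collect_distr[OF meas, of "\<lambda>n. n \<le> j"] measure_atMost_pmf[of D j]
    by (simp only: D atMost_def)
  have "measure D {j<..} = branching_tail p q j" for j
  proof (cases "j \<ge> 1")
    case True
    have "measure N {\<omega> \<in> space N. \<nu> \<omega> \<le> j} = (1 - q ^ j) / (1 - q ^ (j + 1))"
      using functional_equation_iff[OF p q M X, of "measure N {\<omega> \<in> space N. \<nu> \<omega> \<le> j}" j] eq[OF True] by simp
    then show ?thesis
      using branching_tail_compl[OF p q, of j] cdf[of j] by linarith
  next
    case False
    then have "j = 0"
      by simp
    \<comment> \<open>The functional equation is imposed only for \<open>j \<ge> 1\<close>; at 0 the
      tail is 1 because \<open>\<nu>\<close> is positive almost surely.\<close>
    have "measure N {\<omega> \<in> space N. \<nu> \<omega> \<le> 0} = measure N {}"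
      using pos meas by (intro measure_eq_AE) auto
    then show ?thesis
      using \<open>j = 0\<close> cdf[of 0] branching_tail_0[OF p q] by simp
  qed
  then show thesis
    using that D by blast
qed

theorem proposition3:
  fixes p q :: real and M :: "'a measure" and X :: "'a \<Rightarrow> nat"
  assumes "0 < p" "p < 1" "q = 1 - p"
    and "prob_space M" "geometric_rv M p X"
  shows
    "(\<forall>j. \<P>(\<omega> in M. X \<omega> \<le> j) = 1 - q ^ j) \<and>
     (\<forall>j. 1 - \<P>(\<omega> in M. X \<omega> \<le> j) = q ^ j \<and> q ^ j = (LINT u:{0..1}|return borel q. u ^ j)) \<and>
     completely_monotone (\<lambda>j. 1 - \<P>(\<omega> in M. X \<omega> \<le> j)) \<and>
     infinitely_divisible (distr M borel (\<lambda>\<omega>. real (X \<omega>) - 1)) \<and>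
     (\<forall>F :: nat \<Rightarrow> real.
        (\<forall>j\<ge>1. F j \<in> {0..1} \<and> \<P>(\<omega> in M. X \<omega> \<le> j) = pgf M X (F j)) \<longleftrightarrow>
        (\<forall>j\<ge>1. F j = (1 - q ^ j) / (1 - q ^ (j + 1)))) \<and>
     (\<exists>D :: nat pmf. branching_number M X (measure_pmf D) (\<lambda>n. n)) \<and>
     (\<forall>(N :: 'b measure) \<nu>. branching_number M X N \<nu> \<longrightarrow>
        (\<forall>j\<ge>1. \<P>(\<omega> in N. \<nu> \<omega> \<le> j) = (1 - q ^ j) / (1 - q ^ (j + 1))) \<and>
        (\<forall>j. 1 - \<P>(\<omega> in N. \<nu> \<omega> \<le> j) = \<P>(\<omega> in N. \<nu> \<omega> > j)) \<and>
        completely_monotone (\<lambda>j. 1 - \<P>(\<omega> in N. \<nu> \<omega> \<le> j)) \<and>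
        infinitely_divisible (distr N borel (\<lambda>\<omega>. real (\<nu> \<omega>) - 1)) \<and>
        decreasing_failure_rate N \<nu> \<and>
        (\<forall>(P :: 'c measure) (B :: nat \<Rightarrow> 'c \<Rightarrow> bool).
           prob_space P \<and>
           prob_space.indep_vars P (\<lambda>_. count_space UNIV) B {1..} \<and>
           (\<forall>i\<ge>1. distr P (count_space UNIV) (B i)
                    = measure_pmf (bernoulli_pmf (1 / (\<Sum>k\<le>i. q ^ k)))) \<longrightarrow>
           distr N (count_space UNIV) (\<lambda>\<omega>. enat (\<nu> \<omega>))
             = distr P (count_space UNIV) (\<lambda>\<omega>. Inf (enat ` {i. 1 \<le> i \<and> B i \<omega>}))) \<and>
        (\<forall>(P :: 'd measure) (G :: 'd \<Rightarrow> nat) (\<xi> :: nat \<Rightarrow> 'd \<Rightarrow> nat).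
           prob_space P \<and>
           geometric_rv P p G \<and>
           (\<forall>i\<ge>1. geometric_rv P p (\<xi> i)) \<and>
           prob_space.indep_vars P (\<lambda>_. count_space UNIV) \<xi> {1..} \<and>
           prob_space.indep_rvs P (count_space UNIV) G
             (Pi\<^sub>M {1..} (\<lambda>_. count_space UNIV)) (\<lambda>\<omega>. \<lambda>i\<in>{1..}. \<xi> i \<omega>) \<longrightarrow>
           distr N (count_space UNIV) \<nu>
             = distr P (count_space UNIV) (\<lambda>\<omega>. Min ((\<lambda>i. \<xi> i \<omega>) ` {1..G \<omega>}))) \<and>
        geometric_tail N \<nu> q \<and>
        geometric_tail M X q \<and>
        (\<lambda>j. \<P>(\<omega> in N. \<nu> \<omega> > j) / \<P>(\<omega> in M. X \<omega> > j)) \<longlonglongrightarrow> p \<and> p < 1)"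
proof -
  note p = assms(1,2) and q = assms(3) and M = assms(4) and X = assms(5)
  note ctx = p q
  have q01: "0 < q" "q < 1"
    using p q by auto
  have cdf: "\<P>(\<omega> in M. X \<omega> \<le> j) = 1 - q ^ j" and tail: "\<P>(\<omega> in M. X \<omega> > j) = q ^ j" for j
    using geometric_rv_prob[OF p M X] q by simp_all
  have compl: "1 - \<P>(\<omega> in M. X \<omega> \<le> j) = q ^ j" for j
    by (simp add: cdf)
  have moment: "q ^ j = (LINT u:{0..1}|return borel q. u ^ j)" for j
    unfolding set_lebesgue_integral_def using q01 by (subst integral_return) auto
  \<comment> \<open>A mixture with a single term: weight 1 at \<open>m = 0\<close> and ratio
    \<open>q\<close>.\<close>
  have geometric_cm: "completely_monotone (\<lambda>j. 1 - \<P>(\<omega> in M. X \<omega> \<le> j))"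
  proof (rule completely_monotone_mixture)
    fix j m :: nat
    show "(if m = 0 then 1 else 0 :: real) \<ge> 0" "q \<in> {0..1}"
      using q01 by auto
    show "(\<lambda>m. (if m = 0 then 1 else 0) * q ^ j) sums (1 - \<P>(\<omega> in M. X \<omega> \<le> j))"
      using sums_single[of 0 "\<lambda>_. q ^ j"] by (simp add: compl if_distrib[of "\<lambda>x. x * _"] cong: if_cong)
  qed (simp add: compl)
  have X_meas: "X \<in> measurable M (count_space UNIV)"
    using X by (simp add: geometric_rv_def)
  \<comment> \<open>Geometric masses satisfy the log-convexity inequality with equality.\<close>
  have geometric_id: "infinitely_divisible (distr M borel (\<lambda>\<omega>. real (X \<omega>) - 1))"
    using p by (intro infinitely_divisible_shifted[OF X_meas geometric_rv_law[OF p M X]])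
      (auto simp: pmf_map_inj' pmf_eq_0_set_pmf)
  \<comment> \<open>Needed for the converse direction of the uniqueness claim, where the values of
    \<open>F\<close> must be shown to lie in the unit interval. The upper bound holds because the
    complement is a positive tail.\<close>
  have F_bounds: "(1 - q ^ j) / (1 - q ^ (j + 1)) \<in> {0..1}" for j
    using branching_tail_pos[OF ctx, of j] branching_tail_compl[OF ctx, of j] q_power_less_1[OF ctx, of j] q01
    by (auto simp: power_le_one simp del: power_Suc intro!: divide_nonneg_nonneg)
  have uniqueness: "(\<forall>j\<ge>1. F j \<in> {0..1} \<and> \<P>(\<omega> in M. X \<omega> \<le> j) = pgf M X (F j)) \<longleftrightarrow>
      (\<forall>j\<ge>1. F j = (1 - q ^ j) / (1 - q ^ (j + 1)))" for F :: "nat \<Rightarrow> real"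
  proof -
    have "F j \<in> {0..1} \<and> \<P>(\<omega> in M. X \<omega> \<le> j) = pgf M X (F j) \<longleftrightarrow>
        F j = (1 - q ^ j) / (1 - q ^ (j + 1))" for j
      using functional_equation_iff[OF ctx M X, of "F j" j] F_bounds[of j] by auto
    then show ?thesis
      by blast
  qed
  have existence: "\<exists>D :: nat pmf. branching_number M X (measure_pmf D) (\<lambda>n. n)"
  proof -
    obtain D :: "nat pmf" where D: "\<And>j. measure D {j<..} = branching_tail p q j"
      using exists_branching_pmf[OF ctx] by blast
    have cdf_D: "\<P>(n in measure_pmf D. n \<le> j) = (1 - q ^ j) / (1 - q ^ (j + 1))" for j
      using measure_atMost_pmf[of D j] branching_tail_compl[OF ctx, of j]
      by (simp add: D atMost_def[symmetric])
    have "0 \<notin> set_pmf D"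
      using branching_pmf_0[OF ctx D] by (simp add: set_pmf_iff)
    then have "AE n in measure_pmf D. 1 \<le> n"
      by (auto simp: AE_measure_pmf_iff intro!: Suc_leI gr0I)
    moreover have "\<P>(\<omega> in M. X \<omega> \<le> j) = pgf M X (\<P>(n in measure_pmf D. n \<le> j))" for j
      using functional_equation_iff[OF ctx M X, of "\<P>(n in measure_pmf D. n \<le> j)" j] cdf_D[of j]
      by simp
    ultimately show ?thesis
      by (auto simp: branching_number_def measure_pmf.prob_space_axioms)
  qed
  show ?thesis
  proof (intro conjI allI impI, fact cdf, fact compl, fact moment, fact geometric_cm, fact geometric_id,
      fact uniqueness, fact existence)
    fix N :: "'b measure" and \<nu>
    assume N: "branching_number M X N \<nu>"
    have \<nu>: "\<nu> \<in> measurable N (count_space UNIV)"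
      using N by (simp add: branching_number_def)
    obtain D where law: "distr N (count_space UNIV) \<nu> = measure_pmf D"
      and D: "\<And>j. measure D {j<..} = branching_tail p q j"
      using branching_number_law[OF ctx M X N] by metis
    have prob: "\<P>(\<omega> in N. Q (\<nu> \<omega>)) = measure D {n. Q n}" for Q
      using measure_Collect_distr[OF \<nu>] law by simp
    have tail_\<nu>: "\<P>(\<omega> in N. \<nu> \<omega> > j) = branching_tail p q j" for j
      using prob[of "\<lambda>n. n > j"] D[of j] by (simp only: greaterThan_def)
    have cdf_\<nu>: "\<P>(\<omega> in N. \<nu> \<omega> \<le> j) = 1 - branching_tail p q j" for j
      using prob[of "\<lambda>n. n \<le> j"] D[of j] measure_atMost_pmf[of D j] by (simp only: atMost_def)
    show "infinitely_divisible (distr N borel (\<lambda>\<omega>. real (\<nu> \<omega>) - 1))"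
      using branching_pmf_0[OF ctx D] branching_pmf_Suc_pos[OF ctx D] branching_pmf_log_convex[OF ctx D]
      by (intro infinitely_divisible_shifted[OF \<nu> law])
    show "decreasing_failure_rate N \<nu>"
    proof -
      have rate: "\<P>(\<omega> in N. \<nu> \<omega> = j) / \<P>(\<omega> in N. j \<le> \<nu> \<omega>) = p / (1 - q ^ Suc j)" if j: "j \<ge> 1" for j
      proof -
        obtain k where k: "j = Suc k"
          using j by (cases j) auto
        then have "\<P>(\<omega> in N. \<nu> \<omega> = j) = pmf D (Suc k)"
          using prob[of "\<lambda>n. n = j"] by (simp add: measure_pmf_single)
        moreover have "\<P>(\<omega> in N. j \<le> \<nu> \<omega>) = measure D {k<..}"
          using prob[of "\<lambda>n. j \<le> n"] k by (simp add: Suc_le_eq greaterThan_def)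
        ultimately show ?thesis
          by (simp only: branching_failure_rate[OF ctx D] k)
      qed
      have "p / (1 - q ^ Suc j) \<le> p / (1 - q ^ Suc i)" if "i \<le> j" for i j
        using q_power_less_1[OF ctx, of i] q_power_less_1[OF ctx, of j] p q01 that
        by (intro divide_left_mono mult_pos_pos)
          (auto intro!: power_decreasing simp del: power_Suc)
      then show ?thesis
        unfolding decreasing_failure_rate_def by (intro monotone_onI) (auto simp: rate simp del: power_Suc)
    qed
    show "distr N (count_space UNIV) (\<lambda>\<omega>. enat (\<nu> \<omega>))
        = distr P (count_space UNIV) (\<lambda>\<omega>. Inf (enat ` {i. 1 \<le> i \<and> B i \<omega>}))"
      if "prob_space P \<and> prob_space.indep_vars P (\<lambda>_. count_space UNIV) B {1..} \<and>
        (\<forall>i\<ge>1. distr P (count_space UNIV) (B i) = measure_pmf (bernoulli_pmf (1 / (\<Sum>k\<le>i. q ^ k))))"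
      for P :: "'c measure" and B
    proof -
      have "distr N (count_space UNIV) (\<lambda>\<omega>. enat (\<nu> \<omega>))
          = distr (distr N (count_space UNIV) \<nu>) (count_space UNIV) enat"
        using \<nu> by (subst distr_distr) (auto simp: comp_def)
      also have "\<dots> = distr P (count_space UNIV) (\<lambda>\<omega>. Inf (enat ` {i. 1 \<le> i \<and> B i \<omega>}))"
        unfolding law using that by (intro Bernoulli_waiting_time_law[OF ctx D, symmetric]) auto
      finally show ?thesis .
    qed
    show "distr N (count_space UNIV) \<nu>
        = distr P (count_space UNIV) (\<lambda>\<omega>. Min ((\<lambda>i. \<xi> i \<omega>) ` {1..G \<omega>}))"
      if "prob_space P \<and> geometric_rv P p G \<and> (\<forall>i\<ge>1. geometric_rv P p (\<xi> i)) \<and>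
        prob_space.indep_vars P (\<lambda>_. count_space UNIV) \<xi> {1..} \<and>
        prob_space.indep_rvs P (count_space UNIV) G
          (Pi\<^sub>M {1..} (\<lambda>_. count_space UNIV)) (\<lambda>\<omega>. \<lambda>i\<in>{1..}. \<xi> i \<omega>)"
      for P :: "'d measure" and G \<xi>
      unfolding law using that by (intro geometric_minimum_law[OF ctx D, symmetric]) auto
    \<comment> \<open>The asymptotic constant is \<open>p\<close>, the limit of the ratio of the
      tail to \<open>q ^ j\<close>.\<close>
    show "geometric_tail N \<nu> q"
      using asymp_equivI'_const[OF branching_tail_ratio_tendsto[OF ctx]] p q01
      unfolding geometric_tail_def tail_\<nu> by auto
    show "geometric_tail M X q"
      using q01 unfolding geometric_tail_def tail by (auto intro!: exI[of _ 1])
    show "completely_monotone (\<lambda>j. 1 - \<P>(\<omega> in N. \<nu> \<omega> \<le> j))"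
      using completely_monotone_branching_tail[OF ctx] by (simp add: cdf_\<nu>)
    show "\<P>(\<omega> in N. \<nu> \<omega> \<le> j) = (1 - q ^ j) / (1 - q ^ (j + 1))" if "1 \<le> j" for j
      using cdf_\<nu>[of j] branching_tail_compl[OF ctx, of j] by simp
    show "(\<lambda>j. \<P>(\<omega> in N. \<nu> \<omega> > j) / \<P>(\<omega> in M. X \<omega> > j)) \<longlonglongrightarrow> p"
      unfolding tail_\<nu> tail by (rule branching_tail_ratio_tendsto[OF ctx])
    show "1 - \<P>(\<omega> in N. \<nu> \<omega> \<le> j) = \<P>(\<omega> in N. \<nu> \<omega> > j)" for j
      by (simp add: cdf_\<nu> tail_\<nu>)
    show "p < 1"
      by (fact p)
  qed
qed

end
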